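(* Let $\mathcal V\subset\mathbb R^2$ be the von-Koch curve with its standard maps $l_1,l_2,l_3,l_4$, boundary $V_0=\{q_1,q_2\}$ and standard harmonic structure. Let $\mathcal J\subset\mathbb R$ be compact, let $u:V_1\to\mathbb R$ have values in $\mathcal J$, and for $n=1,2,3,4$ let $h_n:\mathcal V\to\mathbb R$ be a nonconstant harmonic function and $s_n:\mathcal J\to\mathcal J$ an Edelstein contraction such that $h_n(x)+s_n(y)\in\mathcal J$ for all $(x,y)\in\mathcal V\times\mathcal J$ and $h_n(q_k)+s_n(u(q_k))=u(l_n(q_k))$ for $n\in\{1,2,3,4\}$, $k\in\{1,2\}$. Let $f^*:\mathcal V\to\mathcal J$ be the unique continuous function with $f^*|_{V_1}=u$ and $$f^*(l_n(x))=s_n(f^*(x))+h_n(x)\qquad (x\in\mathcal V,\ n=1,2,3,4),$$ and let $G=\{(x,f^*(x)):x\in\mathcal V\}\subset\mathbb R^3$ be its graph. Assume that the interpolation points $(t,u(t))$, $t\in V_1$, are not coplanar. Put $\mu=\sum_{n=1}^4L(s_n)$. Then the box-counting dimension of $G$ has the following upper bounds: (i) if $\mu>2$, then $\overline{\dim}_B(G)\le 1+\dfrac{\log\mu}{\log3}$; (ii) if $\mu\le 2$, then $\overline{\dim}_B(G)\le\dfrac{\log6}{\log3}$.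
   Context: Von-Koch curve: $\mathcal V$ is the unique nonempty compact set with $\mathcal V=\bigcup_{n=1}^4l_n(\mathcal V)$, where $l_1(x,y)=\frac13(x,y)$, $l_2(x,y)=\frac13\big(\frac{x-\sqrt3y}2,\frac{\sqrt3x+y}2\big)+(\frac13,0)$, $l_3(x,y)=\frac13\big(\frac{x+\sqrt3y}2,\frac{y-\sqrt3x}2\big)+(\frac12,\frac1{2\sqrt3})$, $l_4(x,y)=\frac13(x,y)+(\frac23,0)$. $q_1=(0,0)$, $q_2=(1,0)$, $V_0=\{q_1,q_2\}$, $V_m=\bigcup_{w\in\{1,2,3,4\}^m}l_w(V_0)$, where $l_w=l_{w_1}\circ\cdots\circ l_{w_m}$. Graph energies for the standard harmonic structure: $\mathcal E_m(v)=4^m\sum_{w\in\{1,2,3,4\}^m}\big(v(l_w(q_1))-v(l_w(q_2))\big)^2$. A harmonic function is a continuous $h:\mathcal V\to\mathbb R$ such that for each $m\ge1$, $h|_{V_m}$ minimizes $\mathcal E_m$ among functions on $V_m$ with the same values on $V_0$. An Edelstein contraction on $\mathcal J$ is a map $s:\mathcal J\to\mathcal J$ with $|s(y)-s(y')|<|y-y'|$ whenever $y\ne y'$. $L(s)=\sup_{y\ne y'\in\mathcal J}\frac{|s(y)-s(y')|}{|y-y'|}$. For a nonempty set $F\subset\mathbb R^{d}$, $N_\delta(F)$ is the number of cubes of side length $\delta$ needed to cover $F$, and $\overline{\dim}_B(F)=\limsup_{\delta\to0}\frac{\log N_\delta(F)}{-\log\delta}$ is the upper box-counting dimension. *)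

theory Defs
  imports "HOL-Analysis.Analysis"
begin

(* Only the indices 1, 2, 3, 4 are meaningful; every use restricts n to {1..4}. *)
definition koch_map :: "nat \<Rightarrow> real \<times> real \<Rightarrow> real \<times> real" where
  "koch_map n = (\<lambda>(x, y).
     if n = 1 then (1/3) *\<^sub>R (x, y)
     else if n = 2 then
       (1/3) *\<^sub>R ((x - sqrt 3 * y) / 2, (sqrt 3 * x + y) / 2) + (1/3, 0)
     else if n = 3 then
       (1/3) *\<^sub>R ((x + sqrt 3 * y) / 2, (y - sqrt 3 * x) / 2) + (1/2, 1 / (2 * sqrt 3))
     else (1/3) *\<^sub>R (x, y) + (2/3, 0))"

definition koch_curve :: "(real \<times> real) set" where
  "koch_curve = (THE K. K \<noteq> {} \<and> compact K \<and> K = (\<Union>n\<in>{1..4}. koch_map n ` K))"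

definition words :: "nat \<Rightarrow> nat list set" where
  "words m = {w. set w \<subseteq> {1..4} \<and> length w = m}"

(* koch_word [w1, ..., wm] is the composition l_{w1} o ... o l_{wm}. *)
definition koch_word :: "nat list \<Rightarrow> real \<times> real \<Rightarrow> real \<times> real" where
  "koch_word w = foldr koch_map w"

definition koch_q1 :: "real \<times> real" where "koch_q1 = (0, 0)"

definition koch_q2 :: "real \<times> real" where "koch_q2 = (1, 0)"

definition koch_V :: "nat \<Rightarrow> (real \<times> real) set" where
  "koch_V m = (\<Union>w\<in>words m. koch_word w ` {koch_q1, koch_q2})"

definition koch_energy :: "nat \<Rightarrow> (real \<times> real \<Rightarrow> real) \<Rightarrow> real" where
  "koch_energy m v =
     4 ^ m * (\<Sum>w\<in>words m. (v (koch_word w koch_q1) - v (koch_word w koch_q2))\<^sup>2)"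

(* The competitors v are total functions on the plane; koch_energy m only
   depends on their values on koch_V m, which contains koch_V 0 = {q1, q2}. *)
definition koch_harmonic :: "(real \<times> real \<Rightarrow> real) \<Rightarrow> bool" where
  "koch_harmonic h \<longleftrightarrow>
     continuous_on koch_curve h \<and>
     (\<forall>m\<ge>1. \<forall>v. (\<forall>q\<in>koch_V 0. v q = h q) \<longrightarrow> koch_energy m h \<le> koch_energy m v)"

definition edelstein_contraction :: "real set \<Rightarrow> (real \<Rightarrow> real) \<Rightarrow> bool" where
  "edelstein_contraction J s \<longleftrightarrow>
     s ` J \<subseteq> J \<and> (\<forall>y\<in>J. \<forall>y'\<in>J. y \<noteq> y' \<longrightarrow> \<bar>s y - s y'\<bar> < \<bar>y - y'\<bar>)"

(* A real supremum: meaningful when J has at least two points and the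
   quotients are bounded, e.g. by 1 for an Edelstein contraction. *)
definition lip_const :: "real set \<Rightarrow> (real \<Rightarrow> real) \<Rightarrow> real" where
  "lip_const J s = Sup {\<bar>s y - s y'\<bar> / \<bar>y - y'\<bar> | y y'. y \<in> J \<and> y' \<in> J \<and> y \<noteq> y'}"

(* Least number of axis-parallel closed cubes of side length d covering F, given
   by the finite sets A of their lower corners; infinite if there is no finite cover. *)
definition box_count :: "real \<Rightarrow> 'a::euclidean_space set \<Rightarrow> enat" where
  "box_count d F =
     (INF A\<in>{A. finite A \<and> F \<subseteq> (\<Union>a\<in>A. cbox a (a + d *\<^sub>R One))}. enat (card A))"

definition upper_box_dim :: "'a::euclidean_space set \<Rightarrow> ereal" where
  "upper_box_dim F =
     Limsup (at_right 0) (\<lambda>d. case box_count d F of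
        enat N \<Rightarrow> ereal (ln (real N) / - ln d) | \<infinity> \<Rightarrow> \<infinity>)"

end

theory Submission
  imports Defs
begin

text \<open>Let \<open>\<nu> = max \<mu> 2\<close> and let \<open>O\<^sub>m\<close> be the sum of the oscillations of \<open>f\<close> over the \<open>4 ^ m\<close>
  cells of level \<open>m\<close>. The functional equation gives \<open>O\<^sub>m\<^sub>+\<^sub>1 \<le> \<mu> O\<^sub>m + C (4/3) ^ m\<close>, where the second
  term bounds the oscillations of the harmonic functions; as \<open>4/3 < 2\<close>, it follows that
  \<open>O\<^sub>m \<le> B \<nu> ^ m\<close>. Cells of level \<open>m\<close> have diameter of order \<open>3 ^ (- m)\<close>, so the graph is covered
  by a constant times \<open>3 ^ m O\<^sub>m + 4 ^ m\<close>, hence by a constant times \<open>(3 \<nu>) ^ m\<close>, cubes of side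
  \<open>3 ^ (- m)\<close>. The harmonic functions are controlled by energy only: summing square roots of cell
  energies along nested vertices with the Cauchy-Schwarz inequality bounds their oscillations.\<close>

section \<open>The attractor and its cells\<close>

lemma attractor_subset:
  fixes \<phi> :: "'i \<Rightarrow> 'a::metric_space \<Rightarrow> 'a"
  assumes r: "0 \<le> r" "r < 1"
    and contr: "\<And>i x y. i \<in> I \<Longrightarrow> dist (\<phi> i x) (\<phi> i y) \<le> r * dist x y"
    and A: "bounded A" "A \<subseteq> (\<Union>i\<in>I. \<phi> i ` A)"
    and B: "closed B" "bounded B" "B \<noteq> {}" "(\<Union>i\<in>I. \<phi> i ` B) \<subseteq> B"
  shows "A \<subseteq> B"
proof
  fix a assume "a \<in> A"
  obtain D where D: "\<And>x y. x \<in> A \<union> B \<Longrightarrow> y \<in> A \<union> B \<Longrightarrow> dist x y \<le> D"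
    using A(1) B(2) by (meson bounded_Un bounded_two_points)
  \<comment> \<open>Unrolling \<open>x\<close> through \<open>k\<close> maps inside \<open>A\<close>
    and replaying the same maps on a point of \<open>B\<close> shrinks an initial distance of at
    most \<open>D\<close> by \<open>r ^ k\<close>; closedness of \<open>B\<close> then puts
    \<open>a\<close> itself in \<open>B\<close>.\<close>
  have *: "\<exists>b\<in>B. dist x b \<le> r ^ k * D" if "x \<in> A" for x k
    using that
  proof (induction k arbitrary: x)
    case 0
    then show ?case using B(3) D by auto
  next
    case (Suc k)
    then obtain i y where i: "i \<in> I" "y \<in> A" "x = \<phi> i y" using A(2) by blast
    with Suc.IH obtain b where b: "b \<in> B" "dist y b \<le> r ^ k * D" by blast
    have "dist x (\<phi> i b) \<le> r * (r ^ k * D)"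
      using contr[OF i(1), of y b] b(2) r(1) i(3) by (meson mult_left_mono order_trans)
    moreover have "\<phi> i b \<in> B" using i b B(4) by blast
    ultimately show ?case by (auto simp: mult.assoc)
  qed
  have "\<exists>b\<in>B. dist b a < e" if "e > 0" for e
  proof -
    have "(\<lambda>k. r ^ k * D) \<longlonglongrightarrow> 0 * D"
      using r by (intro tendsto_intros LIMSEQ_realpow_zero) auto
    then have "\<forall>\<^sub>F k in sequentially. r ^ k * D < e"
      using that by (auto dest: order_tendstoD(2))
    then obtain k where "r ^ k * D < e"
      by (auto simp: eventually_sequentially)
    then show ?thesis using *[OF \<open>a \<in> A\<close>, of k] by (force simp: dist_commute)
  qed
  then show "a \<in> B" using B(1) by (meson closed_approachable)
qed

text \<open>Nested compactness: a closed ball that the system maps into itself has a decreasing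
  sequence of compact nonempty images, and their intersection is invariant.\<close>

lemma attractor_exists:
  fixes \<phi> :: "'i \<Rightarrow> 'a::heine_borel \<Rightarrow> 'a"
  assumes I: "finite I" "I \<noteq> {}" and r: "0 \<le> r" "r < 1"
    and contr: "\<And>i x y. i \<in> I \<Longrightarrow> dist (\<phi> i x) (\<phi> i y) \<le> r * dist x y"
  obtains K where "K \<noteq> {}" "compact K" "K = (\<Union>i\<in>I. \<phi> i ` K)"
proof -
  define z :: 'a where "z = undefined"
  \<comment> \<open>Any centre \<open>z\<close> works. The radius must satisfy
    \<open>dist z (\<phi> i z) + r * R \<le> R\<close> for every \<open>i\<close>, so that the ball
    is mapped into itself; the sum stands in for a maximum over \<open>i\<close>.\<close>
  define R where "R = (\<Sum>i\<in>I. dist z (\<phi> i z)) / (1 - r)"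
  have R: "dist z (\<phi> i z) \<le> (1 - r) * R" if "i \<in> I" for i
    using that I r by (auto simp: R_def intro!: member_le_sum)
  have R0: "R \<ge> 0" using r by (auto simp: R_def intro!: sum_nonneg divide_nonneg_nonneg)
  define F where "F S = (\<Union>i\<in>I. \<phi> i ` S)" for S
  have F_mono: "S \<subseteq> T \<Longrightarrow> F S \<subseteq> F T" for S T by (auto simp: F_def)
  have cont: "continuous_on S (\<phi> i)" if "i \<in> I" for i S
  proof (rule continuous_on_subset[of UNIV])
    show "continuous_on UNIV (\<phi> i)"
      using contr[OF that] r by (intro lipschitz_on_continuous_on[of r] lipschitz_onI) auto
  qed auto
  define Q where "Q m = (F ^^ m) (cball z R)" for m
  have Q_Suc: "Q (Suc m) = F (Q m)" for m by (simp add: Q_def)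
  have compact_Q: "compact (Q m)" for m
  proof (induction m)
    case (Suc m)
    then show ?case
      unfolding Q_Suc F_def by (intro compact_UN I compact_continuous_image cont) auto
  qed (simp add: Q_def)
  have Q_ne: "Q m \<noteq> {}" for m
  proof (induction m)
    case (Suc m)
    then show ?case using I unfolding Q_Suc F_def by auto
  qed (simp add: Q_def not_less R0)
  have Q_dec: "Q (Suc m) \<subseteq> Q m" for m
  proof (induction m)
    case 0
    show ?case
    proof
      fix x assume "x \<in> Q (Suc 0)"
      then obtain i y where i: "i \<in> I" "x = \<phi> i y" "dist z y \<le> R"
        by (auto simp: Q_def F_def)
      have "dist z x \<le> dist z (\<phi> i z) + r * dist z y"
        using contr[OF i(1), of z y] dist_triangle[of z x "\<phi> i z"] i(2) by simp
      also have "\<dots> \<le> (1 - r) * R + r * R"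
        using R[OF i(1)] i(3) r(1) by (intro add_mono mult_left_mono) auto
      finally show "x \<in> Q 0" by (simp add: Q_def algebra_simps)
    qed
  next
    case (Suc m)
    then show ?case using F_mono Q_Suc by metis
  qed
  then have Q_anti: "Q n \<subseteq> Q m" if "m \<le> n" for m n
    using that by (rule lift_Suc_antimono_le)
  define K where "K = \<Inter> (range Q)"
  have "K \<noteq> {}" unfolding K_def using compact_Q Q_ne Q_anti by (intro compact_nest) auto
  moreover have "compact K" unfolding K_def
    using compact_Q by (intro compact_Inter) auto
  moreover have "F K \<subseteq> K"
  proof -
    have "F K \<subseteq> Q m" for m
    proof -
      have "F K \<subseteq> Q (Suc m)" unfolding Q_Suc by (rule F_mono) (auto simp: K_def)
      then show ?thesis using Q_dec by blast
    qed
    then show ?thesis by (auto simp: K_def)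
  qed
  moreover have "K \<subseteq> F K"
  proof
    fix x assume x: "x \<in> K"
    \<comment> \<open>Each \<open>Q (Suc m)\<close> supplies an index that may depend on
      \<open>m\<close>. As \<open>I\<close> is finite and the sets decrease, one index serves all
      levels: otherwise every index fails from some level on, and all fail at
      \<open>N\<close>.\<close>
    have "\<exists>i\<in>I. \<forall>m. x \<in> \<phi> i ` Q m"
    proof (rule ccontr)
      assume "\<not> ?thesis"
      then obtain M where M: "\<And>i. i \<in> I \<Longrightarrow> x \<notin> \<phi> i ` Q (M i)" by metis
      define N where "N = Max (M ` I)"
      have "x \<in> F (Q N)" using x by (metis K_def INT_iff Q_Suc UNIV_I)
      then obtain i where i: "i \<in> I" "x \<in> \<phi> i ` Q N" by (auto simp: F_def)
      have "M i \<le> N" using i I by (auto simp: N_def)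
      then show False using M[OF i(1)] i(2) Q_anti by blast
    qed
    then obtain i where i: "i \<in> I" "\<And>m. x \<in> \<phi> i ` Q m" by blast
    \<comment> \<open>The preimages of \<open>x\<close> under this one map form nested nonempty
      compact sets; a common point lies in \<open>K\<close> and is mapped to
      \<open>x\<close>.\<close>
    define P where "P m = Q m \<inter> \<phi> i -` {x}" for m
    have "\<Inter> (range P) \<noteq> {}"
    proof (rule compact_nest)
      show "compact (P m)" for m
        unfolding P_def
        by (intro compact_Int_closed compact_Q closed_vimage cont[OF i(1), of UNIV]) auto
      show "P m \<noteq> {}" for m using i(2)[of m] by (auto simp: P_def)
      show "P n \<subseteq> P m" if "m \<le> n" for m n using Q_anti[OF that] by (auto simp: P_def)
    qed
    then obtain y where "\<And>m. y \<in> Q m" "\<phi> i y = x" by (auto simp: P_def)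
    then show "x \<in> F K" using i(1) by (auto simp: F_def K_def)
  qed
  ultimately show ?thesis using that[of K] by (auto simp: F_def)
qed

section \<open>The Koch similarities and the curve\<close>

lemma sqrt3_mult: "sqrt 3 * (sqrt 3 * x) = 3 * x"
  by (simp flip: mult.assoc)

lemma koch_map_simps:
  "koch_map (Suc 0) (x, y) = (x / 3, y / 3)"
  "koch_map 2 (x, y) = ((x - sqrt 3 * y) / 6 + 1/3, (sqrt 3 * x + y) / 6)"
  "koch_map 3 (x, y) = ((x + sqrt 3 * y) / 6 + 1/2, (y - sqrt 3 * x) / 6 + sqrt 3 / 6)"
  "koch_map 4 (x, y) = (x / 3 + 2/3, y / 3)"
proof -
  have "1 / (2 * sqrt 3) = sqrt 3 / 6" by (simp add: field_simps)
  then show "koch_map 3 (x, y) =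
      ((x + sqrt 3 * y) / 6 + 1/2, (y - sqrt 3 * x) / 6 + sqrt 3 / 6)"
    by (simp add: koch_map_def)
qed (simp_all add: koch_map_def)

lemma index_cases: "n \<in> {1..4::nat} \<Longrightarrow> n = Suc 0 \<or> n = 2 \<or> n = 3 \<or> n = 4"
  by auto

lemma dist_koch_map:
  assumes "n \<in> {1..4}"
  shows "dist (koch_map n p) (koch_map n q) = (1/3) * dist p q"
proof -
  obtain a b c d where p: "p = (a, b)" and q: "q = (c, d)" by (metis surj_pair)
  \<comment> \<open>Squaring removes the root of the product metric, and \<open>sqrt3_mult\<close>
    the products of \<open>sqrt 3\<close> left by the two rotations.\<close>
  have "(dist (koch_map n p) (koch_map n q))\<^sup>2 = ((1/3) * dist p q)\<^sup>2"
    using index_cases[OF assms] unfolding p q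
    by (elim disjE; simp add: koch_map_simps dist_Pair_Pair dist_real_def power_divide)
       (simp_all add: field_simps power2_eq_square sqrt3_mult)
  then show ?thesis by (simp add: power2_eq_iff_nonneg)
qed

text \<open>The definite description in \<open>koch_curve\<close> denotes such a set only if exactly
  one exists; applying \<open>attractor_subset\<close> in both directions gives uniqueness.\<close>

lemma
  shows koch_curve_nonempty: "koch_curve \<noteq> {}"
    and compact_koch_curve: "compact koch_curve"
    and koch_curve_eq: "koch_curve = (\<Union>n\<in>{1..4}. koch_map n ` koch_curve)"
proof -
  have contr: "dist (koch_map n x) (koch_map n y) \<le> 1/3 * dist x y" if "n \<in> {1..4}" for n x y
    using dist_koch_map[OF that] by simp
  define P where "P K \<longleftrightarrow> K \<noteq> {} \<and> compact K \<and> K = (\<Union>n\<in>{1..4}. koch_map n ` K)"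
    for K
  have sub: "A \<subseteq> B" if A: "P A" and B: "P B" for A B
  proof (rule attractor_subset[of "1/3" "{1..4}" koch_map, OF _ _ contr])
    show "bounded A" "A \<subseteq> (\<Union>n\<in>{1..4}. koch_map n ` A)"
      using A unfolding P_def by (blast intro: compact_imp_bounded)+
    show "closed B" "bounded B" "B \<noteq> {}" "(\<Union>n\<in>{1..4}. koch_map n ` B) \<subseteq> B"
      using B unfolding P_def by (blast intro: compact_imp_bounded compact_imp_closed)+
  qed auto
  obtain K where "K \<noteq> {}" "compact K" "K = (\<Union>n\<in>{1..4}. koch_map n ` K)"
    by (rule attractor_exists[of "{1..4}" "1/3" koch_map, OF _ _ _ _ contr]) auto
  then have "P K" unfolding P_def by blast
  then have "\<exists>!K. P K" using sub by blast
  then have "P koch_curve" unfolding koch_curve_def P_def by (rule theI')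
  then show "koch_curve \<noteq> {}" "compact koch_curve"
    "koch_curve = (\<Union>n\<in>{1..4}. koch_map n ` koch_curve)"
    unfolding P_def by blast+
qed

lemma koch_map_in_curve: "n \<in> {1..4} \<Longrightarrow> x \<in> koch_curve \<Longrightarrow> koch_map n x \<in> koch_curve"
  using koch_curve_eq by blast

text \<open>The images of the edge from \<open>q1\<close> to \<open>q2\<close> form a chain of four
  edges that starts at \<open>q1\<close>. This adjacency carries increments from one subcell to the
  next.\<close>

lemma koch_map_q1: "koch_map (Suc 0) koch_q1 = koch_q1"
  and koch_map_q_adjacent:
    "koch_map 2 koch_q1 = koch_map (Suc 0) koch_q2"
    "koch_map 3 koch_q1 = koch_map 2 koch_q2"
    "koch_map 4 koch_q1 = koch_map 3 koch_q2"
  by (simp_all add: koch_q1_def koch_q2_def koch_map_simps)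

text \<open>A fixed point of one map is contained in its own image under the system, so
  \<open>attractor_subset\<close> applies to the singleton.\<close>

lemma koch_q1_in_curve: "koch_q1 \<in> koch_curve"
proof -
  have "{koch_q1} \<subseteq> koch_curve"
  proof (rule attractor_subset[of "1/3" "{1..4}" koch_map])
    show "{koch_q1} \<subseteq> (\<Union>i\<in>{1..4}. koch_map i ` {koch_q1})"
      using koch_map_q1 by (auto intro!: bexI[of _ "Suc 0"])
    show "(\<Union>i\<in>{1..4}. koch_map i ` koch_curve) \<subseteq> koch_curve"
      using koch_map_in_curve by blast
  qed (use koch_curve_nonempty compact_koch_curve dist_koch_map in
        \<open>auto intro: compact_imp_bounded compact_imp_closed\<close>)
  then show ?thesis by simp
qed

section \<open>Words and the cells they index\<close>

lemma words_0: "words 0 = {[]}"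
  by (auto simp: words_def)

lemma words_Suc: "words (Suc m) = (\<lambda>(n, w). n # w) ` ({1..4} \<times> words m)"
proof (rule set_eqI)
  show "w \<in> words (Suc m) \<longleftrightarrow> w \<in> (\<lambda>(n, w). n # w) ` ({1..4} \<times> words m)" for w
    by (cases w) (auto simp: words_def)
qed

text \<open>Appending a letter subdivides a cell, which is what nested vertices need; prepending one
  (\<open>words_Suc\<close>) applies a map from outside, as in the functional equation.\<close>

lemma words_snoc_iff: "v @ [n] \<in> words (Suc k) \<longleftrightarrow> v \<in> words k \<and> n \<in> {1..4}"
  by (auto simp: words_def)

lemma words_append: "w \<in> words m \<Longrightarrow> v \<in> words k \<Longrightarrow> w @ v \<in> words (m + k)"
  by (auto simp: words_def)

lemma finite_words: "finite (words m)"
  by (induction m) (auto simp: words_0 words_Suc)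

lemma sum_words_Suc: "(\<Sum>w\<in>words (Suc m). g w) = (\<Sum>n\<in>{1..4}. \<Sum>w\<in>words m. g (n # w))"
  unfolding words_Suc
  by (subst sum.reindex) (auto simp: inj_on_def sum.cartesian_product split_beta)

lemma sum_words_add:
  "(\<Sum>w\<in>words (m + k). g w) = (\<Sum>w\<in>words m. \<Sum>v\<in>words k. g (w @ v))"
  by (induction m arbitrary: g) (simp_all add: words_0 sum_words_Suc)

lemma card_words: "card (words m) = 4 ^ m"
proof -
  have "(\<Sum>w\<in>words m. 1) = (4::nat) ^ m"
    by (induction m) (simp_all only: words_0 sum_words_Suc, simp_all)
  then show ?thesis by simp
qed

lemma koch_word_simps [simp]:
  "koch_word [] x = x"
  "koch_word (n # w) x = koch_map n (koch_word w x)"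
  "koch_word (w @ v) x = koch_word w (koch_word v x)"
  by (simp_all add: koch_word_def)

lemma dist_koch_word:
  "w \<in> words m \<Longrightarrow> dist (koch_word w x) (koch_word w y) = (1/3) ^ m * dist x y"
  by (induction m arbitrary: w) (auto simp: words_0 words_Suc dist_koch_map)

lemma koch_word_in_curve: "w \<in> words m \<Longrightarrow> x \<in> koch_curve \<Longrightarrow> koch_word w x \<in> koch_curve"
  by (induction m arbitrary: w) (auto simp: words_0 words_Suc koch_map_in_curve)

lemma koch_curve_word_cover:
  assumes "x \<in> koch_curve"
  obtains w y where "w \<in> words m" "y \<in> koch_curve" "x = koch_word w y"
proof -
  have "\<exists>w\<in>words m. x \<in> koch_word w ` koch_curve"
    using assms
  proof (induction m arbitrary: x)
    case 0
    then show ?case by (simp add: words_0)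
  next
    case (Suc m)
    then obtain n y where n: "n \<in> {1..4}" "y \<in> koch_curve" "x = koch_map n y"
      using koch_curve_eq by blast
    obtain w z where "w \<in> words m" "z \<in> koch_curve" "y = koch_word w z" using Suc.IH[OF n(2)] by blast
    then show ?case using n(1,3) by (intro bexI[of _ "n # w"]) (auto simp: words_Suc)
  qed
  then show ?thesis using that by blast
qed

section \<open>Oscillation of harmonic functions\<close>

lemma koch_V_0: "koch_V 0 = {koch_q1, koch_q2}"
  by (simp add: koch_V_def words_0)

text \<open>The competitor is affine in the first coordinate, which varies by at most \<open>3 ^ (- m)\<close>
  over an edge of level \<open>m\<close>. The true minimiser would give \<open>(1/4) ^ m\<close> instead of
  \<open>(4/9) ^ m\<close>, but it requires knowing that the vertices of level \<open>m\<close> are distinct.\<close>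

lemma koch_harmonic_increments:
  assumes "koch_harmonic h"
  shows "(\<Sum>w\<in>words m. (h (koch_word w koch_q1) - h (koch_word w koch_q2))\<^sup>2)
    \<le> (h koch_q2 - h koch_q1)\<^sup>2 * (4/9) ^ m"
proof (cases "m = 0")
  \<comment> \<open>Harmonicity speaks of levels \<open>m \<ge> 1\<close> only; at level 0 the sum
    is the single boundary increment.\<close>
  case True
  then show ?thesis by (simp add: words_0 power2_commute)
next
  case False
  define H where "H = h koch_q2 - h koch_q1"
  define v where "v z = h koch_q1 + H * fst z" for z :: "real \<times> real"
  have "\<forall>q\<in>koch_V 0. v q = h q"
    by (simp add: koch_V_0 v_def H_def) (simp add: koch_q1_def koch_q2_def)
  then have "koch_energy m h \<le> koch_energy m v"
    using assms False by (simp add: koch_harmonic_def)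
  then have "(\<Sum>w\<in>words m. (h (koch_word w koch_q1) - h (koch_word w koch_q2))\<^sup>2)
      \<le> (\<Sum>w\<in>words m. (v (koch_word w koch_q1) - v (koch_word w koch_q2))\<^sup>2)"
    by (simp add: koch_energy_def)
  also have "\<dots> \<le> (\<Sum>w\<in>words m. H\<^sup>2 * (1/9) ^ m)"
  proof (rule sum_mono)
    fix w assume w: "w \<in> words m"
    have "\<bar>fst (koch_word w koch_q1) - fst (koch_word w koch_q2)\<bar>
        \<le> dist (koch_word w koch_q1) (koch_word w koch_q2)"
      by (metis dist_fst_le dist_real_def)
    also have "\<dots> = (1/3) ^ m"
      by (simp add: dist_koch_word[OF w] koch_q1_def koch_q2_def dist_Pair_Pair)
    finally have "(fst (koch_word w koch_q1) - fst (koch_word w koch_q2))\<^sup>2 \<le> ((1/3) ^ m)\<^sup>2"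
      by (intro power2_le_iff_abs_le[THEN iffD2]) auto
    also have "((1/3::real) ^ m)\<^sup>2 = (1/9) ^ m"
      by (simp add: power2_eq_square flip: power_mult_distrib)
    finally show "(v (koch_word w koch_q1) - v (koch_word w koch_q2))\<^sup>2 \<le> H\<^sup>2 * (1/9) ^ m"
      by (simp add: v_def power_mult_distrib mult_left_mono flip: right_diff_distrib)
  qed
  also have "\<dots> = H\<^sup>2 * (4/9) ^ m"
    by (simp add: card_words power_divide)
  finally show ?thesis by (simp add: H_def)
qed

text \<open>The power of 4 in \<open>koch_energy\<close> is left out, so that the square root bounds
  every single increment over an edge \<open>k\<close> levels below the cell.\<close>

definition cell_energy :: "(real \<times> real \<Rightarrow> real) \<Rightarrow> nat list \<Rightarrow> nat \<Rightarrow> real" where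
  "cell_energy h w k =
     (\<Sum>v\<in>words k. (h (koch_word (w @ v) koch_q1) - h (koch_word (w @ v) koch_q2))\<^sup>2)"

lemma increment_le_cell_energy:
  assumes "v \<in> words k"
  shows "\<bar>h (koch_word (w @ v) koch_q1) - h (koch_word (w @ v) koch_q2)\<bar>
    \<le> sqrt (cell_energy h w k)"
  unfolding cell_energy_def
  by (rule real_le_rsqrt, subst power2_abs)
     (rule member_le_sum[OF assms], simp_all add: finite_words)

text \<open>The first vertex of child \<open>j\<close> is reached from that of the parent along
  \<open>j - 1\<close> consecutive edges, hence along at most 3.\<close>

lemma child_vertex_increment:
  assumes "v \<in> words k" "j \<in> {1..4}"
  shows "\<bar>h (koch_word (w @ v @ [j]) koch_q1) - h (koch_word (w @ v) koch_q1)\<bar>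
    \<le> 3 * sqrt (cell_energy h w (Suc k))"
proof -
  define p where "p i = h (koch_word (w @ v @ [i]) koch_q1)" for i
  define q where "q i = h (koch_word (w @ v @ [i]) koch_q2)" for i
  have *: "\<bar>p i - q i\<bar> \<le> sqrt (cell_energy h w (Suc k))" if "i \<in> {1..4}" for i
    using increment_le_cell_energy[of "v @ [i]" "Suc k" h w] that assms(1)
    by (simp add: words_snoc_iff p_def q_def)
  have "p 2 = q (Suc 0)" "p 3 = q 2" "p 4 = q 3" "p (Suc 0) = h (koch_word (w @ v) koch_q1)"
    by (simp_all add: p_def q_def koch_map_q1 koch_map_q_adjacent)
  moreover have "sqrt (cell_energy h w (Suc k)) \<ge> 0"
    by (simp add: cell_energy_def sum_nonneg)
  ultimately have "\<bar>p j - h (koch_word (w @ v) koch_q1)\<bar> \<le> 3 * sqrt (cell_energy h w (Suc k))"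
    using index_cases[OF assms(2)] *[of "Suc 0"] *[of 2] *[of 3] by auto
  then show ?thesis by (simp add: p_def)
qed

text \<open>Telescoping over the prefixes of \<open>v\<close>, one letter at a time.\<close>

lemma descendant_vertex_increment:
  assumes "v \<in> words k"
  shows "\<bar>h (koch_word (w @ v) koch_q1) - h (koch_word w koch_q1)\<bar>
    \<le> 3 * (\<Sum>i<k. sqrt (cell_energy h w (Suc i)))"
  using assms
proof (induction k arbitrary: v)
  case 0
  then show ?case by (simp add: words_0)
next
  case (Suc k)
  then have "v \<noteq> []" by (auto simp: words_def)
  then obtain u j where v: "v = u @ [j]" by (metis rev_exhaust)
  then have "u \<in> words k" "j \<in> {1..4}" using Suc.prems by (auto simp: words_snoc_iff)
  then show ?case
    using Suc.IH[of u] child_vertex_increment[of u k j h w] unfolding v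
    by (simp add: algebra_simps)
qed

text \<open>Cauchy-Schwarz over \<open>4 ^ m\<close> cells turns the decay
  \<open>(4/9) ^ (m + k)\<close> of the increments into \<open>(16/9) ^ m * (4/9) ^ k\<close>, whose
  root is the stated rate. Growth in \<open>m\<close> stays below 2 and decay in \<open>k\<close> is
  summable.\<close>

lemma koch_harmonic_cell_energy_le:
  assumes "koch_harmonic h"
  shows "(\<Sum>w\<in>words m. sqrt (cell_energy h w k))
    \<le> \<bar>h koch_q2 - h koch_q1\<bar> * (4/3) ^ m * (2/3) ^ k"
proof (rule power2_le_imp_le)
  have nn: "cell_energy h w k \<ge> 0" for w by (simp add: cell_energy_def sum_nonneg)
  have "(\<Sum>w\<in>words m. sqrt (cell_energy h w k))\<^sup>2
      \<le> (\<Sum>w\<in>words m. (sqrt (cell_energy h w k))\<^sup>2) * 4 ^ m"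
    using sum_squared_le_sum_of_squares[of "\<lambda>w. sqrt (cell_energy h w k)" "words m"]
    by (simp add: card_words)
  also have "(\<Sum>w\<in>words m. (sqrt (cell_energy h w k))\<^sup>2) =
      (\<Sum>w\<in>words (m + k). (h (koch_word w koch_q1) - h (koch_word w koch_q2))\<^sup>2)"
    unfolding sum_words_add using nn by (simp add: cell_energy_def)
  also have "\<dots> * 4 ^ m \<le> (h koch_q2 - h koch_q1)\<^sup>2 * (4/9) ^ (m + k) * 4 ^ m"
    using koch_harmonic_increments[OF assms] by (intro mult_right_mono) auto
  also have "\<dots> = (h koch_q2 - h koch_q1)\<^sup>2 * (((4/3) ^ 2) ^ m) * (((2/3) ^ 2) ^ k)"
    by (simp add: power_add power2_eq_square flip: power_mult_distrib)
  also have "\<dots> = (\<bar>h koch_q2 - h koch_q1\<bar> * (4/3) ^ m * (2/3) ^ k)\<^sup>2"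
    by (simp only: power_mult_distrib power2_abs mult.commute flip: power_mult)
  finally show "(\<Sum>w\<in>words m. sqrt (cell_energy h w k))\<^sup>2 \<le> \<dots>" .
qed simp

text \<open>One cell is dominated by the sum over all cells of its level, which decays geometrically
  in \<open>k\<close>.\<close>

lemma summable_cell_energy:
  assumes "koch_harmonic h" "w \<in> words m"
  shows "summable (\<lambda>k. sqrt (cell_energy h w (Suc k)))"
proof (rule summable_comparison_test')
  define H where "H = \<bar>h koch_q2 - h koch_q1\<bar> * (4/3) ^ m"
  show "summable (\<lambda>k. H * (2/3) ^ Suc k)"
    by (intro summable_mult) (simp add: summable_Suc_iff)
  have nn: "cell_energy h w k \<ge> 0" for w k by (simp add: cell_energy_def sum_nonneg)
  show "norm (sqrt (cell_energy h w (Suc k))) \<le> H * (2/3) ^ Suc k" for k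
  proof -
    have "sqrt (cell_energy h w (Suc k)) \<le> (\<Sum>w\<in>words m. sqrt (cell_energy h w (Suc k)))"
      by (rule member_le_sum[OF assms(2)]) (simp_all add: nn finite_words)
    also have "\<dots> \<le> H * (2/3) ^ Suc k"
      unfolding H_def by (rule koch_harmonic_cell_energy_le[OF assms(1)])
    finally show ?thesis using nn by simp
  qed
qed

text \<open>Vertices of ever finer subcells containing the point converge to it, so continuity
  carries the bound from vertices to the whole cell.\<close>

lemma koch_harmonic_oscillation:
  assumes h: "koch_harmonic h" and w: "w \<in> words m"
    and x: "x \<in> koch_curve"
  shows "\<bar>h (koch_word w x) - h (koch_word w koch_q1)\<bar>
    \<le> 3 * (\<Sum>k. sqrt (cell_energy h w (Suc k)))" (is "_ \<le> ?D")
proof -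
  have "\<exists>v\<in>words k. \<exists>y\<in>koch_curve. x = koch_word v y" for k
    using koch_curve_word_cover[OF x] by metis
  \<comment> \<open>The words \<open>v k\<close> are chosen separately for each \<open>k\<close> and
    need not extend one another: each \<open>z k\<close> is compared directly with the base vertex
    of the cell.\<close>
  then obtain v y where v: "\<And>k. v k \<in> words k" and y: "\<And>k. y k \<in> koch_curve"
    and xy: "\<And>k. x = koch_word (v k) (y k)" by metis
  define z where "z k = koch_word (w @ v k) koch_q1" for k
  have dist: "dist (z k) (koch_word w x) \<le> diameter koch_curve * (1/3) ^ k" for k
  proof -
    have "dist (z k) (koch_word w x) = (1/3) ^ (m + k) * dist koch_q1 (y k)"
      using dist_koch_word[OF words_append[OF w v[of k]]] xy[of k] by (metis z_def koch_word_simps(3))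
    also have "\<dots> \<le> (1/3) ^ k * diameter koch_curve"
      using diameter_bounded_bound[OF compact_imp_bounded[OF compact_koch_curve] koch_q1_in_curve y[of k]]
      by (intro mult_mono power_decreasing) auto
    finally show ?thesis by (simp add: mult.commute)
  qed
  have "(\<lambda>k. diameter koch_curve * (1/3) ^ k) \<longlonglongrightarrow> 0"
    by (intro tendsto_mult_right_zero LIMSEQ_realpow_zero) auto
  moreover have "\<forall>k. norm (dist (z k) (koch_word w x)) \<le> diameter koch_curve * (1/3) ^ k"
    using dist by simp
  ultimately have "(\<lambda>k. dist (z k) (koch_word w x)) \<longlonglongrightarrow> 0"
    by (rule Lim_null_comparison[OF always_eventually, rotated])
  then have z: "z \<longlonglongrightarrow> koch_word w x" by (rule tendsto_dist_iff[THEN iffD2])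
  have "continuous_on koch_curve h" using h by (simp add: koch_harmonic_def)
  from this z have "(\<lambda>k. h (z k)) \<longlonglongrightarrow> h (koch_word w x)"
  proof (rule continuous_on_tendsto_compose)
    show "koch_word w x \<in> koch_curve" by (rule koch_word_in_curve[OF w x])
    show "\<forall>\<^sub>F k in sequentially. z k \<in> koch_curve"
      unfolding z_def
      using koch_word_in_curve[OF words_append[OF w v] koch_q1_in_curve]
      by (intro always_eventually allI)
  qed
  then have "(\<lambda>k. \<bar>h (z k) - h (koch_word w koch_q1)\<bar>)
      \<longlonglongrightarrow> \<bar>h (koch_word w x) - h (koch_word w koch_q1)\<bar>"
    by (intro tendsto_intros)
  moreover have "\<bar>h (z k) - h (koch_word w koch_q1)\<bar> \<le> ?D" for k
  proof -
    have "(\<Sum>i<k. sqrt (cell_energy h w (Suc i))) \<le> (\<Sum>k. sqrt (cell_energy h w (Suc k)))"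
      by (rule sum_le_suminf[OF summable_cell_energy[OF h w]])
         (auto simp: cell_energy_def sum_nonneg)
    then show ?thesis using descendant_vertex_increment[OF v[of k], of h w] by (simp add: z_def)
  qed
  ultimately show ?thesis by (intro LIMSEQ_le_const2) auto
qed

section \<open>Oscillation over cells\<close>

definition osc :: "(real \<times> real \<Rightarrow> real) \<Rightarrow> nat list \<Rightarrow> real" where
  "osc g w = diameter ((\<lambda>x. g (koch_word w x)) ` koch_curve)"

lemma osc_le:
  assumes "\<And>x y. x \<in> koch_curve \<Longrightarrow> y \<in> koch_curve \<Longrightarrow>
    \<bar>g (koch_word w x) - g (koch_word w y)\<bar> \<le> D"
  shows "osc g w \<le> D"
  unfolding osc_def by (rule diameter_le) (use koch_curve_nonempty assms in auto)

lemma
  assumes g: "continuous_on koch_curve g" and w: "w \<in> words m"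
  shows osc_nonneg: "0 \<le> osc g w"
    and le_osc: "\<And>x y. x \<in> koch_curve \<Longrightarrow> y \<in> koch_curve \<Longrightarrow>
      \<bar>g (koch_word w x) - g (koch_word w y)\<bar> \<le> osc g w"
proof -
  have "bounded (g ` koch_curve)"
    using g compact_koch_curve by (intro compact_imp_bounded compact_continuous_image)
  then have b: "bounded ((\<lambda>x. g (koch_word w x)) ` koch_curve)"
    by (rule bounded_subset) (use koch_word_in_curve[OF w] in auto)
  then show "0 \<le> osc g w" unfolding osc_def by (rule diameter_ge_0)
  show "\<bar>g (koch_word w x) - g (koch_word w y)\<bar> \<le> osc g w"
    if "x \<in> koch_curve" "y \<in> koch_curve" for x y
    using diameter_bounded_bound[OF b] that by (auto simp: osc_def dist_real_def)
qed

text \<open>Passing through the base vertex doubles the factor 3 to 6. Exchanging the finite sum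
  with the series leaves the powers of \<open>2/3\<close> from exponent 1 on, whose sum is 2; hence
  12.\<close>

lemma koch_harmonic_sum_osc:
  assumes h: "koch_harmonic h"
  shows "(\<Sum>w\<in>words m. osc h w) \<le> 12 * \<bar>h koch_q2 - h koch_q1\<bar> * (4/3) ^ m"
proof -
  define H where "H = \<bar>h koch_q2 - h koch_q1\<bar> * (4/3) ^ m"
  define e where "e w k = sqrt (cell_energy h w (Suc k))" for w k
  have e: "summable (e w)" if "w \<in> words m" for w
    unfolding e_def by (rule summable_cell_energy[OF h that])
  have "osc h w \<le> 6 * (\<Sum>k. e w k)" if "w \<in> words m" for w
  proof (rule osc_le)
    show "\<bar>h (koch_word w x) - h (koch_word w y)\<bar> \<le> 6 * (\<Sum>k. e w k)"
      if "x \<in> koch_curve" "y \<in> koch_curve" for x y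
      using koch_harmonic_oscillation[OF h \<open>w \<in> words m\<close> that(1)]
        koch_harmonic_oscillation[OF h \<open>w \<in> words m\<close> that(2)]
      unfolding e_def by linarith
  qed
  then have "(\<Sum>w\<in>words m. osc h w) \<le> 6 * (\<Sum>w\<in>words m. \<Sum>k. e w k)"
    unfolding sum_distrib_left by (rule sum_mono)
  also have "(\<Sum>w\<in>words m. \<Sum>k. e w k) = (\<Sum>k. \<Sum>w\<in>words m. e w k)"
    by (rule suminf_sum[symmetric]) (rule e)
  also have "\<dots> \<le> (\<Sum>k. H * (2/3) ^ Suc k)"
  proof (rule suminf_le)
    show "(\<Sum>w\<in>words m. e w k) \<le> H * (2/3) ^ Suc k" for k
      unfolding e_def H_def by (rule koch_harmonic_cell_energy_le[OF h])
    show "summable (\<lambda>k. \<Sum>w\<in>words m. e w k)" by (rule summable_sum) (rule e)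
    show "summable (\<lambda>k. H * (2/3) ^ Suc k)"
      by (intro summable_mult) (simp add: summable_Suc_iff)
  qed
  also have "\<dots> = 2 * H"
  proof -
    have "(\<lambda>k. (H * (2/3)) * (2/3) ^ k) sums ((H * (2/3)) * (1 / (1 - 2/3)))"
      by (intro sums_mult geometric_sums) auto
    then show ?thesis by (simp add: sums_iff mult.assoc)
  qed
  finally show ?thesis by (simp add: H_def)
qed

section \<open>Oscillation and box dimension of the graph\<close>

lemma edelstein_lip_const:
  assumes "edelstein_contraction J s" "y \<in> J" "y' \<in> J"
  shows "\<bar>s y - s y'\<bar> \<le> lip_const J s * \<bar>y - y'\<bar>"
    and "y \<noteq> y' \<Longrightarrow> 0 \<le> lip_const J s"
proof -
  have le: "\<bar>s y - s y'\<bar> / \<bar>y - y'\<bar> \<le> lip_const J s" if "y \<noteq> y'"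
    unfolding lip_const_def
  proof (rule cSup_upper)
    \<comment> \<open>The Edelstein property bounds all quotients by 1, so the supremum is a genuine
      upper bound.\<close>
    show "bdd_above {\<bar>s y - s y'\<bar> / \<bar>y - y'\<bar> | y y'. y \<in> J \<and> y' \<in> J \<and> y \<noteq> y'}"
      using assms(1) by (intro bdd_aboveI[of _ 1]) (force simp: edelstein_contraction_def)
  qed (use that assms in blast)
  show "\<bar>s y - s y'\<bar> \<le> lip_const J s * \<bar>y - y'\<bar>"
    using le by (cases "y = y'") (auto simp: field_simps)
  \<comment> \<open>Two distinct points are required: over a one-point \<open>J\<close> the supremum
    is that of the empty set and its sign is not known.\<close>
  show "0 \<le> lip_const J s" if "y \<noteq> y'"
    using le[OF that] by (rule order_trans[rotated]) simp
qed

lemma osc_Cons_le: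
  assumes n: "n \<in> {1..4}" and w: "w \<in> words m"
    and s: "edelstein_contraction J s"
    and f: "continuous_on koch_curve f" "f ` koch_curve \<subseteq> J"
    and g: "continuous_on koch_curve g"
    and f_eq: "\<And>x. x \<in> koch_curve \<Longrightarrow> f (koch_map n x) = s (f x) + g x"
  shows "osc f (n # w) \<le> lip_const J s * osc f w + osc g w"
proof (rule osc_le)
  fix x y assume xy: "x \<in> koch_curve" "y \<in> koch_curve"
  define X Y where "X = koch_word w x" and "Y = koch_word w y"
  note curve = koch_word_in_curve[OF w]
  have XY: "X \<in> koch_curve" "Y \<in> koch_curve" using xy curve by (auto simp: X_def Y_def)
  then have J: "f X \<in> J" "f Y \<in> J" using f(2) by auto
  have "lip_const J s * \<bar>f X - f Y\<bar> \<le> lip_const J s * osc f w"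
  proof (cases "0 \<le> lip_const J s")
    case True
    then show ?thesis
      using le_osc[OF f(1) w xy] by (intro mult_left_mono) (auto simp: X_def Y_def)
  next
    case False
    \<comment> \<open>A negative constant rules out two distinct values in \<open>J\<close>; then
      \<open>f\<close> is constant on the cell and both sides vanish.\<close>
    have eq: "f (koch_word w x) = f (koch_word w y)" if "x \<in> koch_curve" "y \<in> koch_curve" for x y
    proof (rule ccontr)
      assume neq: "f (koch_word w x) \<noteq> f (koch_word w y)"
      have "f (koch_word w x) \<in> J" "f (koch_word w y) \<in> J"
        using f(2) curve[OF that(1)] curve[OF that(2)] by auto
      then show False using edelstein_lip_const(2)[OF s _ _ neq] False by simp
    qed
    have "osc f w \<le> 0"
    proof (rule osc_le)
      show "\<bar>f (koch_word w x) - f (koch_word w y)\<bar> \<le> 0"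
        if "x \<in> koch_curve" "y \<in> koch_curve" for x y
        unfolding eq[OF that] by simp
    qed
    then have "osc f w = 0" using osc_nonneg[OF f(1) w] by linarith
    moreover have "f X = f Y" unfolding X_def Y_def by (rule eq[OF xy])
    ultimately show ?thesis by simp
  qed
  moreover have "\<bar>s (f X) - s (f Y)\<bar> \<le> lip_const J s * \<bar>f X - f Y\<bar>"
    using edelstein_lip_const(1)[OF s J] .
  moreover have "\<bar>g X - g Y\<bar> \<le> osc g w"
    using le_osc[OF g w xy] by (simp add: X_def Y_def)
  moreover have "f (koch_word (n # w) x) = s (f X) + g X" "f (koch_word (n # w) y) = s (f Y) + g Y"
    using f_eq XY by (simp_all add: X_def Y_def)
  ultimately show "\<bar>f (koch_word (n # w) x) - f (koch_word (n # w) y)\<bar>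
      \<le> lip_const J s * osc f w + osc g w" by linarith
qed

lemma sum_osc_growth:
  assumes h: "\<And>n. n \<in> {1..4} \<Longrightarrow> koch_harmonic (h n)"
    and s: "\<And>n. n \<in> {1..4} \<Longrightarrow> edelstein_contraction J (s n)"
    and f: "continuous_on koch_curve f" "f ` koch_curve \<subseteq> J"
    and f_eq: "\<And>n x. n \<in> {1..4} \<Longrightarrow> x \<in> koch_curve \<Longrightarrow>
                 f (koch_map n x) = s n (f x) + h n x"
    and \<nu>: "\<nu> \<ge> (\<Sum>n\<in>{1..4}. lip_const J (s n))" "\<nu> \<ge> 2"
  obtains B where "B \<ge> 0" "\<And>m. (\<Sum>w\<in>words m. osc f w) \<le> B * \<nu> ^ m"
proof -
  define S where "S m = (\<Sum>w\<in>words m. osc f w)" for m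
  define C where "C = (\<Sum>n\<in>{1..4}. 12 * \<bar>h n koch_q2 - h n koch_q1\<bar>)"
  have S0: "S m \<ge> 0" for m unfolding S_def by (intro sum_nonneg osc_nonneg[OF f(1)])
  have C0: "C \<ge> 0" unfolding C_def by (intro sum_nonneg) auto
  have step: "S (Suc m) \<le> \<nu> * S m + C * (4/3) ^ m" for m
  proof -
    have "S (Suc m) = (\<Sum>n\<in>{1..4}. \<Sum>w\<in>words m. osc f (n # w))"
      by (simp only: S_def sum_words_Suc)
    also have "\<dots> \<le> (\<Sum>n\<in>{1..4}. \<Sum>w\<in>words m. lip_const J (s n) * osc f w + osc (h n) w)"
      using h s f f_eq
      by (intro sum_mono osc_Cons_le[where J = J]) (auto simp: koch_harmonic_def)
    also have "\<dots> = (\<Sum>n\<in>{1..4}. lip_const J (s n)) * S m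
        + (\<Sum>n\<in>{1..4}. \<Sum>w\<in>words m. osc (h n) w)"
      by (simp only: sum.distrib S_def sum_product)
    \<comment> \<open>Enlarging the sum of the Lipschitz constants to \<open>\<nu>\<close> relies on
      \<open>S m \<ge> 0\<close>.\<close>
    also have "\<dots> \<le> \<nu> * S m + (\<Sum>n\<in>{1..4}. 12 * \<bar>h n koch_q2 - h n koch_q1\<bar> * (4/3) ^ m)"
      using \<nu>(1) S0 h by (intro add_mono mult_right_mono sum_mono koch_harmonic_sum_osc)
    finally show ?thesis by (simp only: C_def sum_distrib_right)
  qed
  \<comment> \<open>The factor \<open>3/2\<close> solves \<open>1 + (4/3) * c = 2 * c\<close>: with
    the correction \<open>c * C * (4/3) ^ m\<close> added, the inhomogeneous recurrence becomes
    growth by the factor \<open>\<nu> \<ge> 2\<close>.\<close>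
  define B where "B = S 0 + C * (3/2)"
  have "S m + C * (3/2) * (4/3) ^ m \<le> B * \<nu> ^ m" for m
  proof (induction m)
    case (Suc m)
    have "C * (4/3) ^ m * 2 \<le> C * (4/3) ^ m * \<nu>"
      using \<nu>(2) C0 by (intro mult_left_mono) auto
    then have "S (Suc m) + C * (3/2) * (4/3) ^ Suc m \<le> \<nu> * (S m + C * (3/2) * (4/3) ^ m)"
      using step[of m] by (simp add: algebra_simps)
    also have "\<dots> \<le> \<nu> * (B * \<nu> ^ m)" using Suc.IH \<nu>(2) by (intro mult_left_mono) auto
    finally show ?case by (simp add: algebra_simps)
  qed (simp add: B_def)
  moreover have "C * (3/2) * (4/3) ^ m \<ge> 0" for m using C0 by simp
  ultimately have "S m \<le> B * \<nu> ^ m" for m by (smt (verit))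
  moreover have "B \<ge> 0" using S0[of 0] C0 by (simp add: B_def)
  ultimately show ?thesis using that S_def by simp
qed

section \<open>Covers by cubes and the upper box dimension\<close>

lemma interval_cover:
  fixes t :: real
  assumes "d > 0" "M > 0" "a \<le> t" "t \<le> a + real M * d"
  obtains i where "i < M" "a + real i * d \<le> t" "t \<le> a + real i * d + d"
proof (cases "t = a + real M * d")
  \<comment> \<open>At the right endpoint the floor would give the index \<open>M\<close>, one too
    many; the last interval contains it.\<close>
  case True
  have "real (M - 1) = real M - 1" using assms(2) by (simp add: of_nat_diff)
  then show ?thesis using that[of "M - 1"] assms True by (simp add: algebra_simps)
next
  case False
  define i where "i = nat \<lfloor>(t - a) / d\<rfloor>"
  have "0 \<le> (t - a) / d" using assms by simp
  then have i: "real i \<le> (t - a) / d" "(t - a) / d < real i + 1"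
    by (simp_all add: i_def)
  have "(t - a) / d < real M" using assms False by (simp add: divide_less_eq)
  then have "i < M" using i by linarith
  then show ?thesis using that[of i] i assms(1) by (simp add: field_simps)
qed

lemma box_cover:
  fixes S :: "((real \<times> real) \<times> real) set"
  assumes d: "d > 0" and M: "M > 0" "P > 0"
    and S: "\<And>x y z. ((x, y), z) \<in> S \<Longrightarrow> a \<le> x \<and> x \<le> a + real M * d \<and>
      b \<le> y \<and> y \<le> b + real M * d \<and> c \<le> z \<and> z \<le> c + real P * d"
  obtains A where "finite A" "card A \<le> M * M * P" "S \<subseteq> (\<Union>a\<in>A. cbox a (a + d *\<^sub>R One))"
proof -
  define e where "e = (\<lambda>(i, j, k). ((a + real i * d, b + real j * d), c + real k * d))"
  define A where "A = e ` ({..<M} \<times> {..<M} \<times> {..<P})"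
  have One: "(One :: (real \<times> real) \<times> real) = ((1, 1), 1)"
    by (simp add: Basis_prod_def sum.union_disjoint sum.reindex inj_on_def disjoint_iff
        comm_monoid_add_class.sum.insert zero_prod_def image_iff)
  have "finite A" by (simp add: A_def)
  moreover have "card A \<le> M * M * P"
    unfolding A_def by (rule order_trans[OF card_image_le]) (simp_all add: card_cartesian_product)
  moreover have "S \<subseteq> (\<Union>a\<in>A. cbox a (a + d *\<^sub>R One))"
  proof
    fix p assume "p \<in> S"
    obtain x y z where p: "p = ((x, y), z)" by (metis surj_pair)
    note S = S[OF \<open>p \<in> S\<close>[unfolded p]]
    obtain i where i: "i < M" "a + real i * d \<le> x" "x \<le> a + real i * d + d"
      using interval_cover[OF d M(1), of a x] S by blast
    obtain j where j: "j < M" "b + real j * d \<le> y" "y \<le> b + real j * d + d"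
      using interval_cover[OF d M(1), of b y] S by blast
    obtain k where k: "k < P" "c + real k * d \<le> z" "z \<le> c + real k * d + d"
      using interval_cover[OF d M(2), of c z] S by blast
    have "p \<in> cbox (e (i, j, k)) (e (i, j, k) + d *\<^sub>R One)"
      using i j k by (simp add: p e_def One)
    moreover have "e (i, j, k) \<in> A" using i j k by (simp add: A_def)
    ultimately show "p \<in> (\<Union>a\<in>A. cbox a (a + d *\<^sub>R One))" by blast
  qed
  ultimately show ?thesis by (rule that)
qed

text \<open>After taking logarithms, the constant contributes \<open>ln D / - ln d\<close>, which
  vanishes as \<open>d\<close> tends to 0.\<close>

lemma upper_box_dim_le:
  fixes F :: "'a::euclidean_space set"
  assumes \<alpha>: "\<alpha> \<ge> 0"
    and cover: "\<And>d. 0 < d \<Longrightarrow> d < 1 \<Longrightarrow>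
      \<exists>A. finite A \<and> F \<subseteq> (\<Union>a\<in>A. cbox a (a + d *\<^sub>R One)) \<and> real (card A) \<le> C * d powr (- \<alpha>)"
  shows "upper_box_dim F \<le> ereal \<alpha>"
proof -
  \<comment> \<open>Making the constant at least 1 gives \<open>ln D \<ge> 0\<close>. This also
    settles a count of 0, where \<open>ln 0 = 0\<close> by convention.\<close>
  define D where "D = max C 1"
  have "Limsup (at_right 0) (\<lambda>d. case box_count d F of
      enat N \<Rightarrow> ereal (ln (real N) / - ln d) | \<infinity> \<Rightarrow> \<infinity>)
    \<le> Limsup (at_right 0) (\<lambda>d. ereal (\<alpha> + ln D / - ln d))"
  proof (rule Limsup_mono)
    have "(case box_count d F of enat N \<Rightarrow> ereal (ln (real N) / - ln d) | \<infinity> \<Rightarrow> \<infinity>)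
        \<le> ereal (\<alpha> + ln D / - ln d)" if d: "0 < d" "d < 1" for d :: real
    proof -
      obtain A where A: "finite A" "F \<subseteq> (\<Union>a\<in>A. cbox a (a + d *\<^sub>R One))"
        "real (card A) \<le> C * d powr (- \<alpha>)"
        using cover[OF d] by blast
      have "box_count d F \<le> enat (card A)"
        unfolding box_count_def using A by (intro INF_lower) auto
      then obtain N where N: "box_count d F = enat N" "N \<le> card A"
        by (cases "box_count d F") auto
      have ln_d: "- ln d > 0" using d by simp
      have "ln (real N) \<le> ln D + \<alpha> * (- ln d)"
      proof (cases "N = 0")
        case True
        have "0 \<le> ln D" "0 \<le> \<alpha> * (- ln d)"
          using \<alpha> ln_d by (simp_all add: D_def mult_nonneg_nonpos)
        with True show ?thesis by simp
      next
        case False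
        have "real N \<le> C * d powr (- \<alpha>)" using N(2) A(3) by linarith
        also have "\<dots> \<le> D * d powr (- \<alpha>)" by (intro mult_right_mono) (auto simp: D_def)
        finally have "ln (real N) \<le> ln (D * d powr (- \<alpha>))" using False by (simp add: ln_mono)
        also have "\<dots> = ln D + \<alpha> * (- ln d)"
          using d by (subst ln_mult) (auto simp: D_def ln_powr)
        finally show ?thesis .
      qed
      then have "ln (real N) / - ln d \<le> (ln D + \<alpha> * (- ln d)) / - ln d"
        using ln_d by (intro divide_right_mono) auto
      also have "\<dots> = \<alpha> + ln D / - ln d" using ln_d by (simp add: field_simps)
      finally show ?thesis by (simp add: N(1))
    qed
    then show "\<forall>\<^sub>F d in at_right 0.
        (case box_count d F of enat N \<Rightarrow> ereal (ln (real N) / - ln d) | \<infinity> \<Rightarrow> \<infinity>)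
        \<le> ereal (\<alpha> + ln D / - ln d)"
      unfolding eventually_at_right_field by (intro exI[of _ 1]) auto
  qed
  also have "\<dots> = ereal \<alpha>"
  proof (rule lim_imp_Limsup)
    have "filterlim (\<lambda>d::real. - ln d) at_top (at_right 0)"
      using ln_at_0 by (simp add: filterlim_uminus_at_top)
    then have "((\<lambda>d. ln D / - ln d) \<longlongrightarrow> 0) (at_right 0)"
      by (intro tendsto_divide_0[OF tendsto_const] filterlim_at_top_imp_at_infinity)
    then have "((\<lambda>d. \<alpha> + ln D / - ln d) \<longlongrightarrow> \<alpha> + 0) (at_right 0)"
      by (intro tendsto_add tendsto_const)
    then show "((\<lambda>d. ereal (\<alpha> + ln D / - ln d)) \<longlongrightarrow> ereal \<alpha>) (at_right 0)"
      by (simp add: tendsto_ereal)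
  qed simp
  finally show ?thesis by (simp add: upper_box_dim_def)
qed

text \<open>Over each cell the graph lies in a box centred at the image of \<open>koch_q1\<close>,
  with half-widths \<open>N * d\<close> and half-height \<open>Q w * d\<close>; doubling three sides
  gives 8. Rounding costs at most 2 per cell, whence \<open>2 * 4 ^ m\<close>.\<close>

lemma graph_cover:
  assumes f: "continuous_on koch_curve f" and d: "(1/3) ^ m \<le> d"
  shows "\<exists>A. finite A \<and> {(x, f x) | x. x \<in> koch_curve} \<subseteq> (\<Union>a\<in>A. cbox a (a + d *\<^sub>R One)) \<and>
    real (card A) \<le> 8 * (diameter koch_curve + 2)\<^sup>2 *
      (3 ^ m * (\<Sum>w\<in>words m. osc f w) + 2 * 4 ^ m)"
proof -
  define R where "R = diameter koch_curve"
  have bounded: "bounded koch_curve" by (rule compact_imp_bounded[OF compact_koch_curve])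
  have R0: "R \<ge> 0" unfolding R_def by (rule diameter_ge_0[OF bounded])
  have d0: "d > 0" using d by (rule less_le_trans[rotated]) simp
  define N where "N = nat \<lceil>R\<rceil> + 1"
  have N: "R \<le> real N" "real N \<le> R + 2" "N > 0" using R0 by (auto simp: N_def) linarith+
  \<comment> \<open>The added 1 keeps the count positive when the oscillation is 0, as
    \<open>box_cover\<close> demands.\<close>
  define Q where "Q w = nat \<lceil>osc f w / d\<rceil> + 1" for w
  have Q: "osc f w \<le> real (Q w) * d" "real (Q w) \<le> 3 ^ m * osc f w + 2" "Q w > 0"
    if w: "w \<in> words m" for w
  proof -
    have nn: "0 \<le> osc f w / d" using osc_nonneg[OF f w] d0 by simp
    then have "osc f w / d \<le> real (Q w)" "real (Q w) \<le> osc f w / d + 2"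
      by (auto simp: Q_def) linarith+
    moreover have "osc f w / d \<le> 3 ^ m * osc f w"
    proof -
      have "osc f w / d \<le> osc f w / (1/3) ^ m"
        using d d0 osc_nonneg[OF f w] by (intro divide_left_mono) auto
      then show ?thesis by (simp add: power_divide mult.commute)
    qed
    ultimately show "osc f w \<le> real (Q w) * d" "real (Q w) \<le> 3 ^ m * osc f w + 2"
      using d0 by (simp only: pos_divide_le_eq, linarith)
    show "Q w > 0" by (simp add: Q_def)
  qed
  define S where "S w = (\<lambda>x. (koch_word w x, f (koch_word w x))) ` koch_curve" for w
  have "\<exists>A. finite A \<and> card A \<le> (2 * N) * (2 * N) * (2 * Q w) \<and>
      S w \<subseteq> (\<Union>a\<in>A. cbox a (a + d *\<^sub>R One))" if w: "w \<in> words m" for w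
  proof -
    define p where "p = koch_word w koch_q1"
    have near: "dist (koch_word w x) p \<le> real N * d" if "x \<in> koch_curve" for x
    proof -
      have "dist (koch_word w x) p = (1/3) ^ m * dist x koch_q1"
        unfolding p_def by (rule dist_koch_word[OF w])
      also have "\<dots> \<le> d * R"
        unfolding R_def using d d0 diameter_bounded_bound[OF bounded that koch_q1_in_curve]
        by (intro mult_mono) auto
      also have "\<dots> \<le> d * real N" using N d0 by (intro mult_left_mono) auto
      finally show ?thesis by (simp add: mult.commute)
    qed
    have box: "fst p - real N * d \<le> x \<and> x \<le> fst p - real N * d + real (2 * N) * d \<and>
      snd p - real N * d \<le> y \<and> y \<le> snd p - real N * d + real (2 * N) * d \<and>
      f p - real (Q w) * d \<le> z \<and> z \<le> f p - real (Q w) * d + real (2 * Q w) * d"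
      if xyz: "((x, y), z) \<in> S w" for x y z
    proof -
      obtain v where v: "v \<in> koch_curve" "(x, y) = koch_word w v" "z = f (koch_word w v)"
        using xyz by (auto simp: S_def)
      have "\<bar>x - fst p\<bar> \<le> real N * d" "\<bar>y - snd p\<bar> \<le> real N * d"
        using near[OF v(1)] dist_fst_le[of "(x, y)" p] dist_snd_le[of "(x, y)" p]
        unfolding v(2)[symmetric]
        by (simp_all add: dist_real_def)
      moreover have "\<bar>z - f p\<bar> \<le> real (Q w) * d"
        using le_osc[OF f w v(1) koch_q1_in_curve] Q(1)[OF w] v(3) by (simp add: p_def)
      ultimately show ?thesis by (simp add: abs_le_iff algebra_simps)
    qed
    obtain A where "finite A" "card A \<le> (2 * N) * (2 * N) * (2 * Q w)"
      "S w \<subseteq> (\<Union>a\<in>A. cbox a (a + d *\<^sub>R One))"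
      by (rule box_cover[OF d0 _ _ box]) (use N(3) Q(3)[OF w] in auto)
    then show ?thesis by (intro exI conjI)
  qed
  then have "\<forall>w\<in>words m. \<exists>A. finite A \<and> card A \<le> (2 * N) * (2 * N) * (2 * Q w) \<and>
      S w \<subseteq> (\<Union>a\<in>A. cbox a (a + d *\<^sub>R One))" by blast
  from bchoice[OF this] obtain A where
    A: "\<forall>w\<in>words m. finite (A w) \<and> card (A w) \<le> (2 * N) * (2 * N) * (2 * Q w) \<and>
      S w \<subseteq> (\<Union>a\<in>A w. cbox a (a + d *\<^sub>R One))" by blast
  show ?thesis
  proof (intro exI[of _ "\<Union>w\<in>words m. A w"] conjI)
    show "finite (\<Union>w\<in>words m. A w)" using A finite_words by (intro finite_UN_I) auto
    show "{(x, f x) | x. x \<in> koch_curve} \<subseteq> (\<Union>a\<in>(\<Union>w\<in>words m. A w). cbox a (a + d *\<^sub>R One))"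
    proof safe
      fix x assume "x \<in> koch_curve"
      then obtain w y where w: "w \<in> words m" "y \<in> koch_curve" "x = koch_word w y"
        by (rule koch_curve_word_cover)
      then have "(x, f x) \<in> S w" by (auto simp: S_def)
      then show "(x, f x) \<in> (\<Union>a\<in>(\<Union>w\<in>words m. A w). cbox a (a + d *\<^sub>R One))"
        using bspec[OF A w(1)] w(1) by blast
    qed
    have "card (\<Union>w\<in>words m. A w) \<le> (\<Sum>w\<in>words m. card (A w))"
      by (rule card_UN_le[OF finite_words])
    also have "\<dots> \<le> (\<Sum>w\<in>words m. (2 * N) * (2 * N) * (2 * Q w))"
      by (rule sum_mono) (use A in auto)
    finally have "real (card (\<Union>w\<in>words m. A w)) \<le> real (\<Sum>w\<in>words m. (2 * N) * (2 * N) * (2 * Q w))"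
      by (rule of_nat_mono)
    also have "\<dots> = 8 * (real N)\<^sup>2 * (\<Sum>w\<in>words m. real (Q w))"
      by (simp add: sum_distrib_left power2_eq_square mult_ac)
    also have "\<dots> \<le> 8 * (R + 2)\<^sup>2 * (\<Sum>w\<in>words m. 3 ^ m * osc f w + 2)"
      using N Q(2) by (intro mult_mono sum_mono power_mono) (auto intro: sum_nonneg)
    also have "(\<Sum>w\<in>words m. 3 ^ m * osc f w + 2) = 3 ^ m * (\<Sum>w\<in>words m. osc f w) + 2 * 4 ^ m"
      by (simp add: sum.distrib card_words sum_distrib_left)
    finally show "real (card (\<Union>w\<in>words m. A w)) \<le> 8 * (diameter koch_curve + 2)\<^sup>2 *
      (3 ^ m * (\<Sum>w\<in>words m. osc f w) + 2 * 4 ^ m)" unfolding R_def .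
  qed
qed

text \<open>For the least such \<open>m\<close>, which is positive because \<open>d < 1\<close>, the
  previous power still exceeds \<open>d\<close>.\<close>

lemma triadic_scale:
  fixes d :: real
  assumes "0 < d" "d < 1"
  obtains m where "(1/3) ^ m \<le> d" "3 ^ m \<le> 3 / d"
proof -
  define m where "m = (LEAST m. (1/3) ^ m \<le> d)"
  have "\<exists>m. (1/3) ^ m < d" using assms by (intro real_arch_pow_inv) auto
  then have m: "(1/3) ^ m \<le> d" unfolding m_def by (meson LeastI_ex less_imp_le)
  then have "m \<noteq> 0" using assms(2) by (intro notI) simp
  then obtain k where k: "m = Suc k" by (meson not0_implies_Suc)
  then have "\<not> (1/3) ^ k \<le> d" using not_less_Least[of k "\<lambda>m. (1/3) ^ m \<le> d"] by (simp add: m_def)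
  then have "3 ^ m \<le> 3 / d" using assms(1) by (simp add: k field_simps)
  with m show ?thesis by (rule that)
qed

text \<open>The exponent is chosen so that \<open>3 powr \<alpha> = 3 * \<nu>\<close>; the count
  \<open>(3 * \<nu>) ^ m\<close> is then \<open>(3 ^ m) powr \<alpha>\<close>, and
  \<open>3 ^ m \<le> 3 / d\<close> converts it to the scale \<open>d\<close>.\<close>

lemma graph_dim_le:
  assumes f: "continuous_on koch_curve f" and \<nu>: "\<nu> \<ge> 2"
    and B: "B \<ge> 0" "\<And>m. (\<Sum>w\<in>words m. osc f w) \<le> B * \<nu> ^ m"
  shows "upper_box_dim {(x, f x) | x. x \<in> koch_curve} \<le> ereal (1 + ln \<nu> / ln 3)"
proof (rule upper_box_dim_le)
  define \<alpha> where "\<alpha> = 1 + ln \<nu> / ln 3"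
  show \<alpha>0: "0 \<le> 1 + ln \<nu> / ln 3" using \<nu> by simp
  have ln: "ln \<nu> / ln 3 * ln 3 = ln \<nu>" by simp
  have powr3: "3 powr \<alpha> = 3 * \<nu>"
    using \<nu> unfolding \<alpha>_def powr_add by (simp add: powr_def)
  define D where "D = 8 * (diameter koch_curve + 2)\<^sup>2 * (B + 2)"
  have D0: "D \<ge> 0" using B(1) by (simp add: D_def)
  fix d :: real assume d: "0 < d" "d < 1"
  obtain m where m: "(1/3) ^ m \<le> d" "3 ^ m \<le> 3 / d" using triadic_scale[OF d] .
  obtain A where A: "finite A"
    "{(x, f x) | x. x \<in> koch_curve} \<subseteq> (\<Union>a\<in>A. cbox a (a + d *\<^sub>R One))"
    "real (card A) \<le> 8 * (diameter koch_curve + 2)\<^sup>2 *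
      (3 ^ m * (\<Sum>w\<in>words m. osc f w) + 2 * 4 ^ m)"
    using graph_cover[OF f m(1)] by blast
  note A(3)
  \<comment> \<open>The rounding term is absorbed because
    \<open>4 \<le> 6 \<le> 3 * \<nu>\<close>.\<close>
  also have "3 ^ m * (\<Sum>w\<in>words m. osc f w) + 2 * 4 ^ m \<le> 3 ^ m * (B * \<nu> ^ m) + 2 * (3 * \<nu>) ^ m"
    using B(2) \<nu> by (intro add_mono mult_left_mono power_mono) auto
  also have "\<dots> = (B + 2) * (3 * \<nu>) ^ m" by (simp add: power_mult_distrib algebra_simps)
  also have "8 * (diameter koch_curve + 2)\<^sup>2 * \<dots> = D * (3 * \<nu>) ^ m" by (simp add: D_def)
  also have "(3 * \<nu>) ^ m = (3 powr \<alpha>) powr real m"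
    using \<nu> by (simp add: powr3 powr_realpow)
  also have "\<dots> = (3 powr real m) powr \<alpha>" by (simp add: powr_powr mult.commute)
  also have "\<dots> = (3 ^ m) powr \<alpha>" by (simp add: powr_realpow)
  also have "\<dots> \<le> (3 / d) powr \<alpha>"
    using m(2) \<alpha>0 by (intro powr_mono2) (auto simp: \<alpha>_def)
  also have "(3 / d) powr \<alpha> = 3 * \<nu> * d powr (- \<alpha>)"
    using d by (simp add: powr_divide powr3 powr_minus_divide)
  finally have "real (card A) \<le> D * (3 * \<nu>) * d powr (- \<alpha>)"
    using D0 by (simp add: mult_left_mono mult.assoc)
  then show "\<exists>A. finite A \<and> {(x, f x) | x. x \<in> koch_curve} \<subseteq> (\<Union>a\<in>A. cbox a (a + d *\<^sub>R One)) \<and>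
      real (card A) \<le> (8 * (diameter koch_curve + 2)\<^sup>2 * (B + 2) * (3 * \<nu>)) *
        d powr (- (1 + ln \<nu> / ln 3))"
    using A(1,2) unfolding D_def \<alpha>_def by blast
qed

theorem theorem4p2:
  fixes J :: "real set"
    and u :: "real \<times> real \<Rightarrow> real"
    and h :: "nat \<Rightarrow> real \<times> real \<Rightarrow> real"
    and s :: "nat \<Rightarrow> real \<Rightarrow> real"
    and f :: "real \<times> real \<Rightarrow> real"
    and G :: "((real \<times> real) \<times> real) set"
    and \<mu> :: real
  assumes J: "compact J"
    and u: "u ` koch_V 1 \<subseteq> J"
    and h: "\<And>n. n \<in> {1..4} \<Longrightarrow> koch_harmonic (h n)"
    and h_nonconst: "\<And>n. n \<in> {1..4} \<Longrightarrow> \<not> h n constant_on koch_curve"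
    and s: "\<And>n. n \<in> {1..4} \<Longrightarrow> edelstein_contraction J (s n)"
    and hs: "\<And>n x y. n \<in> {1..4} \<Longrightarrow> x \<in> koch_curve \<Longrightarrow> y \<in> J \<Longrightarrow> h n x + s n y \<in> J"
    and interp: "\<And>n q. n \<in> {1..4} \<Longrightarrow> q \<in> {koch_q1, koch_q2} \<Longrightarrow>
                   h n q + s n (u q) = u (koch_map n q)"
    and f_cont: "continuous_on koch_curve f"
    and f_J: "f ` koch_curve \<subseteq> J"
    and f_u: "\<And>t. t \<in> koch_V 1 \<Longrightarrow> f t = u t"
    and f_eq: "\<And>n x. n \<in> {1..4} \<Longrightarrow> x \<in> koch_curve \<Longrightarrow>
                 f (koch_map n x) = s n (f x) + h n x"
    and G: "G = {(x, f x) | x. x \<in> koch_curve}"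
    and noncoplanar: "\<not> coplanar {(t, u t) | t. t \<in> koch_V 1}"
    and \<mu>: "\<mu> = (\<Sum>n\<in>{1..4}. lip_const J (s n))"
  shows "(\<mu> > 2 \<longrightarrow> upper_box_dim G \<le> ereal (1 + ln \<mu> / ln 3)) \<and>
         (\<mu> \<le> 2 \<longrightarrow> upper_box_dim G \<le> ereal (ln 6 / ln 3))"
proof -
  \<comment> \<open>The maximum treats both cases at once; for \<open>\<mu> \<le> 2\<close> the
    exponent is \<open>1 + ln 2 / ln 3 = ln 6 / ln 3\<close>.\<close>
  define \<nu> where "\<nu> = max \<mu> 2"
  obtain B where "B \<ge> 0" "\<And>m. (\<Sum>w\<in>words m. osc f w) \<le> B * \<nu> ^ m"
    using sum_osc_growth[of h J s f \<nu>] h s f_cont f_J f_eq by (auto simp: \<nu>_def \<mu>)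
  then have dim: "upper_box_dim G \<le> ereal (1 + ln \<nu> / ln 3)"
    unfolding G by (intro graph_dim_le[OF f_cont]) (auto simp: \<nu>_def)
  have "ln 6 = ln 2 + ln (3::real)" using ln_mult[of 2 "3::real"] by simp
  then have "1 + ln 2 / ln 3 = ln 6 / ln (3::real)" by (simp add: field_simps)
  then show ?thesis using dim by (auto simp: \<nu>_def max_def)
qed

end
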